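(* Let $m\ge 1$, $r\ge 0$ and $n\ge 0$ be integers. Then the $r$-Dowling numbers $D_{m,r}(n)=\sum_{k=0}^n W_{m,r}(n,k)$ satisfy $$D_{m,r}(n)=\sum_{j=0}^{n}(-1)^{n-j}\left[\sum_{k=0}^{j}L_{m,r}(j,k)\right]W_{m,r}(n,j),$$ where $W_{m,r}(n,j)$ are the $r$-Whitney numbers of the second kind and $L_{m,r}(j,k)$ are the $r$-Whitney-Lah numbers.
   Context: Write $(x)_n=x(x-1)\cdots(x-n+1)$, $(x)_0=1$, for the falling factorial. The $r$-Whitney numbers of the first kind $w_{m,r}(n,k)$ and of the second kind $W_{m,r}(n,k)$, $0\le k\le n$, are defined by the polynomial identities in $x$ $$m^n(x)_n=\sum_{k=0}^n(-1)^{n-k}w_{m,r}(n,k)(mx+r)^k,\qquad (mx+r)^n=\sum_{k=0}^nm^kW_{m,r}(n,k)(x)_k .$$ The $r$-Whitney-Lah numbers are defined by $$L_{m,r}(n,k)=\sum_{j=k}^{n}w_{m,r}(n,j)W_{m,r}(j,k),\qquad 0\le k\le n.$$ The $r$-Dowling numbers are $D_{m,r}(n)=\sum_{k=0}^n W_{m,r}(n,k)$. *)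

theory Defs
  imports "HOL-Computational_Algebra.Polynomial"
begin

definition falling_fact :: "'a::comm_ring_1 \<Rightarrow> nat \<Rightarrow> 'a" where
  "falling_fact x n = (\<Prod>i<n. x - of_nat i)"

text \<open>The indeterminate x of the defining polynomial identities.\<close>

abbreviation X :: "int poly" where
  "X \<equiv> [:0, 1:]"

text \<open>
  The two kinds of r-Whitney numbers are the coefficients in identities of polynomials over the
  integers. These determine the numbers with k between 0 and n; the numbers with k > n are set
  to 0. For m = 0 the definite descriptions need not denote anything.
\<close>

definition is_r_whitney1 :: "nat \<Rightarrow> nat \<Rightarrow> nat \<Rightarrow> (nat \<Rightarrow> int) \<Rightarrow> bool" where
  "is_r_whitney1 m r n w \<longleftrightarrow>
     of_nat m ^ n * falling_fact X n =
       (\<Sum>k=0..n. (-1) ^ (n - k) * of_int (w k) * (of_nat m * X + of_nat r) ^ k) \<and>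
     (\<forall>k>n. w k = 0)"

definition is_r_whitney2 :: "nat \<Rightarrow> nat \<Rightarrow> nat \<Rightarrow> (nat \<Rightarrow> int) \<Rightarrow> bool" where
  "is_r_whitney2 m r n W \<longleftrightarrow>
     (of_nat m * X + of_nat r) ^ n =
       (\<Sum>k=0..n. of_nat m ^ k * of_int (W k) * falling_fact X k) \<and>
     (\<forall>k>n. W k = 0)"

definition r_whitney1 :: "nat \<Rightarrow> nat \<Rightarrow> nat \<Rightarrow> nat \<Rightarrow> int" where
  "r_whitney1 m r n = (THE w. is_r_whitney1 m r n w)"

definition r_whitney2 :: "nat \<Rightarrow> nat \<Rightarrow> nat \<Rightarrow> nat \<Rightarrow> int" where
  "r_whitney2 m r n = (THE W. is_r_whitney2 m r n W)"

definition r_whitney_lah :: "nat \<Rightarrow> nat \<Rightarrow> nat \<Rightarrow> nat \<Rightarrow> int" where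
  "r_whitney_lah m r n k = (\<Sum>j=k..n. r_whitney1 m r n j * r_whitney2 m r j k)"

definition r_dowling :: "nat \<Rightarrow> nat \<Rightarrow> nat \<Rightarrow> int" where
  "r_dowling m r n = (\<Sum>k=0..n. r_whitney2 m r n k)"


text \<open>For m > 0 the coefficients exist and are unique, so the descriptions denote.\<close>

lemma graded_family_independent:
  fixes p :: "nat \<Rightarrow> int poly" and c :: "nat \<Rightarrow> int"
  assumes deg: "\<And>k. degree (p k) = k" and nz: "\<And>k. p k \<noteq> 0"
    and sum0: "(\<Sum>k=0..n. of_int (c k) * p k) = 0" and "k \<le> n"
  shows "c k = 0"
  using sum0 \<open>k \<le> n\<close>
proof (induction n)
  case 0
  then show ?case using nz[of 0] by simp
next
  case (Suc n)
  have "coeff (\<Sum>k=0..n. of_int (c k) * p k) (Suc n) = 0"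
    by (auto simp: coeff_sum of_int_poly deg intro!: sum.neutral coeff_eq_0)
  moreover have "coeff (\<Sum>k=0..Suc n. of_int (c k) * p k) (Suc n) = 0"
    using Suc.prems(1) by simp
  ultimately have "c (Suc n) * coeff (p (Suc n)) (Suc n) = 0"
    by (simp add: of_int_poly)
  moreover have "coeff (p (Suc n)) (Suc n) \<noteq> 0"
    using leading_coeff_neq_0[OF nz[of "Suc n"]] by (simp add: deg)
  ultimately have "c (Suc n) = 0"
    by simp
  with Suc show ?case
    by (cases "k = Suc n") auto
qed

lemma graded_family_unique:
  fixes p :: "nat \<Rightarrow> int poly" and a b :: "nat \<Rightarrow> int"
  assumes "\<And>k. degree (p k) = k" and "\<And>k. p k \<noteq> 0"
    and "(\<Sum>k=0..n. of_int (a k) * p k) = (\<Sum>k=0..n. of_int (b k) * p k)" and "k \<le> n"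
  shows "a k = b k"
proof -
  have "(\<Sum>k=0..n. of_int (a k - b k) * p k) = 0"
    using assms(3) by (simp add: left_diff_distrib sum_subtractf)
  from graded_family_independent[OF assms(1,2) this assms(4)] show ?thesis by simp
qed

lemma falling_fact_Suc: "falling_fact x (Suc n) = falling_fact x n * (x - of_nat n)"
  by (simp add: falling_fact_def)

lemma X_minus_of_nat: "X - of_nat i = [:- int i, 1:]"
  by (simp add: of_nat_poly)

lemma falling_fact_X_nonzero: "falling_fact X n \<noteq> 0"
  by (simp add: falling_fact_def X_minus_of_nat)

lemma degree_falling_fact_X: "degree (falling_fact X n) = n"
  by (simp add: falling_fact_def X_minus_of_nat degree_prod_sum_eq)

lemma linear_form: "of_nat m * X + of_nat r = [:int r, int m:]"
  by (simp add: of_nat_poly)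

lemma is_r_whitney1_unique:
  assumes "m \<ge> 1" "is_r_whitney1 m r n v" "is_r_whitney1 m r n w"
  shows "v = w"
proof
  fix k
  define p where "p k = (of_nat m * X + of_nat r) ^ k" for k
  have deg: "degree (p k) = k" and nz: "p k \<noteq> 0" for k
    using assms(1) unfolding p_def linear_form by (simp_all add: degree_power_eq)
  have eq: "(\<Sum>k=0..n. of_int ((-1) ^ (n - k) * v k) * p k) =
            (\<Sum>k=0..n. of_int ((-1) ^ (n - k) * w k) * p k)"
    using assms(2,3) by (simp add: is_r_whitney1_def p_def)
  show "v k = w k"
  proof (cases "k \<le> n")
    case True
    from graded_family_unique[OF deg nz eq True] show ?thesis by simp
  next
    case False
    then show ?thesis using assms(2,3) by (simp add: is_r_whitney1_def)
  qed
qed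

lemma is_r_whitney2_unique:
  assumes "m \<ge> 1" "is_r_whitney2 m r n V" "is_r_whitney2 m r n W"
  shows "V = W"
proof
  fix k
  define p where "p k = of_nat m ^ k * falling_fact X k" for k
  have p_eq: "p k = smult (int m ^ k) (falling_fact X k)" for k
    by (simp add: p_def of_nat_poly poly_const_pow)
  have deg: "degree (p k) = k" and nz: "p k \<noteq> 0" for k
    using assms(1) by (simp_all add: p_eq degree_falling_fact_X falling_fact_X_nonzero)
  have eq: "(\<Sum>k=0..n. of_int (V k) * p k) = (\<Sum>k=0..n. of_int (W k) * p k)"
    using assms(2,3) by (simp add: is_r_whitney2_def p_def mult_ac)
  show "V k = W k"
  proof (cases "k \<le> n")
    case True
    from graded_family_unique[OF deg nz eq True] show ?thesis .
  next
    case False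
    then show ?thesis using assms(2,3) by (simp add: is_r_whitney2_def)
  qed
qed

lemma is_r_whitney1_exists: "\<exists>w. is_r_whitney1 m r n w"
proof (induction n)
  case 0
  have "is_r_whitney1 m r 0 (\<lambda>k. if k = 0 then 1 else 0)"
    by (simp add: is_r_whitney1_def falling_fact_def)
  then show ?case by blast
next
  case (Suc n)
  then obtain w where w: "is_r_whitney1 m r n w" ..
  define Y where "Y = of_nat m * X + of_nat r"
  define v where "v k = (case k of 0 \<Rightarrow> 0 | Suc l \<Rightarrow> w l) + (int r + int n * int m) * w k" for k
  have w0: "w k = 0" if "k > n" for k
    using w that by (simp add: is_r_whitney1_def)
  let ?c = "\<lambda>k. (-1) ^ (n - k) * of_int (w k) :: int poly"
  let ?d = "of_nat r + of_nat n * of_nat m :: int poly"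
  have shift: "(\<Sum>k=0..Suc n. (-1) ^ (Suc n - k) * of_int (case k of 0 \<Rightarrow> 0 | Suc l \<Rightarrow> w l) * Y ^ k)
      = (\<Sum>k=0..n. ?c k * Y ^ Suc k)"
    by (subst sum.atLeast0_atMost_Suc_shift) simp
  have stay: "(\<Sum>k=0..Suc n. (-1) ^ (Suc n - k) * of_int ((int r + int n * int m) * w k) * Y ^ k)
      = (\<Sum>k=0..n. - ?d * (?c k * Y ^ k))"
    by (auto simp: w0 Suc_diff_le algebra_simps intro!: sum.cong)
  have "of_nat m ^ Suc n * falling_fact X (Suc n) =
      of_nat m ^ n * falling_fact X n * (Y - ?d)"
    by (simp add: falling_fact_Suc Y_def algebra_simps)
  also have "of_nat m ^ n * falling_fact X n = (\<Sum>k=0..n. ?c k * Y ^ k)"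
    using w by (simp add: is_r_whitney1_def Y_def)
  also have "\<dots> * (Y - ?d) =
      (\<Sum>k=0..n. ?c k * Y ^ Suc k) + (\<Sum>k=0..n. - ?d * (?c k * Y ^ k))"
    unfolding sum_distrib_right sum.distrib[symmetric]
    by (rule sum.cong) (simp_all add: algebra_simps)
  also have "\<dots> = (\<Sum>k=0..Suc n. (-1) ^ (Suc n - k) * of_int (v k) * Y ^ k)"
    unfolding shift[symmetric] stay[symmetric] sum.distrib[symmetric] v_def
    by (rule sum.cong) (simp_all only: of_int_add distrib_left distrib_right)
  finally have "is_r_whitney1 m r (Suc n) v"
    by (auto simp: is_r_whitney1_def Y_def v_def w0 split: nat.split)
  then show ?case by blast
qed

lemma is_r_whitney2_exists: "\<exists>W. is_r_whitney2 m r n W"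
proof (induction n)
  case 0
  have "is_r_whitney2 m r 0 (\<lambda>k. if k = 0 then 1 else 0)"
    by (simp add: is_r_whitney2_def falling_fact_def)
  then show ?case by blast
next
  case (Suc n)
  then obtain W where W: "is_r_whitney2 m r n W" ..
  define Y where "Y = of_nat m * X + of_nat r"
  define V where "V k = (case k of 0 \<Rightarrow> 0 | Suc l \<Rightarrow> W l) + (int m * int k + int r) * W k" for k
  define F where "F k = of_nat m ^ k * falling_fact X k" for k
  have W0: "W k = 0" if "k > n" for k
    using W that by (simp add: is_r_whitney2_def)
  have FY: "F k * Y = F (Suc k) + (of_nat m * of_nat k + of_nat r) * F k" for k
    by (simp add: F_def Y_def falling_fact_Suc algebra_simps)
  have shift: "(\<Sum>k=0..Suc n. of_int (case k of 0 \<Rightarrow> 0 | Suc l \<Rightarrow> W l) * F k)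
      = (\<Sum>k=0..n. of_int (W k) * F (Suc k))"
    by (subst sum.atLeast0_atMost_Suc_shift) simp
  have stay: "(\<Sum>k=0..Suc n. of_int ((int m * int k + int r) * W k) * F k)
      = (\<Sum>k=0..n. of_int (W k) * ((of_nat m * of_nat k + of_nat r) * F k))"
    by (auto simp: W0 intro!: sum.cong)
  have "Y ^ Suc n = Y ^ n * Y"
    by (simp add: mult.commute)
  also have "Y ^ n = (\<Sum>k=0..n. of_int (W k) * F k)"
    using W by (simp add: is_r_whitney2_def Y_def F_def mult_ac)
  also have "\<dots> * Y = (\<Sum>k=0..n. of_int (W k) * F (Suc k)) +
      (\<Sum>k=0..n. of_int (W k) * ((of_nat m * of_nat k + of_nat r) * F k))"
    unfolding sum_distrib_right sum.distrib[symmetric] mult.assoc FY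
    by (simp only: distrib_left)
  also have "\<dots> = (\<Sum>k=0..Suc n. of_int (V k) * F k)"
    unfolding shift[symmetric] stay[symmetric] sum.distrib[symmetric] V_def
    by (rule sum.cong) (simp_all only: of_int_add distrib_right)
  also have "\<dots> = (\<Sum>k=0..Suc n. of_nat m ^ k * of_int (V k) * falling_fact X k)"
    by (rule sum.cong) (simp_all add: F_def)
  finally have "is_r_whitney2 m r (Suc n) V"
    by (auto simp: is_r_whitney2_def Y_def V_def W0 split: nat.split)
  then show ?case by blast
qed

lemma is_r_whitney1_r_whitney1:
  assumes "m \<ge> 1"
  shows "is_r_whitney1 m r n (r_whitney1 m r n)"
  unfolding r_whitney1_def
  by (rule theI'[where P = "is_r_whitney1 m r n"])
    (use is_r_whitney1_exists is_r_whitney1_unique[OF assms] in blast)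

lemma is_r_whitney2_r_whitney2:
  assumes "m \<ge> 1"
  shows "is_r_whitney2 m r n (r_whitney2 m r n)"
  unfolding r_whitney2_def
  by (rule theI'[where P = "is_r_whitney2 m r n"])
    (use is_r_whitney2_exists is_r_whitney2_unique[OF assms] in blast)

end

theory Submission
  imports Defs
begin

text \<open>
  Substituting the expansion of the falling factorials in powers of \<open>m x + r\<close> into the expansion
  of \<open>(m x + r)^n\<close> in falling factorials shows that the two kinds of \<open>r\<close>-Whitney numbers form,
  up to signs, inverse matrices. The inner bracket of the theorem is the transform
  \<open>\<Sum>i. w(j,i) D(i)\<close> of the Dowling numbers, and the outer sum inverts it.
\<close>

lemma r_whitney1_eq_0:
  assumes "m \<ge> 1" "k > n"
  shows "r_whitney1 m r n k = 0"
  using is_r_whitney1_r_whitney1[OF assms(1), of r n] assms(2)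
  by (simp add: is_r_whitney1_def)

lemma minus_one_power_diff_eq_add:
  assumes "k \<le> n"
  shows "(-1) ^ (n - k) = ((-1) ^ (n + k) :: 'a::ring_1)"
  using assms by (simp add: minus_one_power_iff)

text \<open>For \<open>i \<le> n\<close>, compare coefficients of the powers of
  \<open>m x + r\<close>, which are independent because the k-th has degree k when
  \<open>m \<ge> 1\<close>. For \<open>i > n\<close> every term vanishes.\<close>

lemma r_whitney_orthogonal:
  assumes m: "m \<ge> 1"
  shows "(\<Sum>j=0..n. (-1) ^ (n - j) * r_whitney2 m r n j * r_whitney1 m r j i) = of_bool (i = n)"
proof (cases "i \<le> n")
  case False
  then have "r_whitney1 m r j i = 0" if "j \<le> n" for j
    using that by (intro r_whitney1_eq_0[OF m]) simp
  with False show ?thesis by simp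
next
  case True
  define p where "p k = (of_nat m * X + of_nat r) ^ k" for k
  have deg: "degree (p k) = k" and nz: "p k \<noteq> 0" for k
    using m unfolding p_def linear_form by (simp_all add: degree_power_eq)
  \<comment> \<open>The sign \<open>(-1) ^ (j + i)\<close> agrees with \<open>(-1) ^ (j - i)\<close>
    for \<open>i \<le> j\<close> and avoids truncated subtraction once \<open>i\<close> ranges up to
    \<open>n\<close>.\<close>
  define a where "a i = (\<Sum>j=0..n. (-1) ^ (j + i) * r_whitney2 m r n j * r_whitney1 m r j i)" for i
  have w: "of_nat m ^ j * falling_fact X j =
      (\<Sum>i=0..n. of_int ((-1) ^ (j + i) * r_whitney1 m r j i) * p i)" if "j \<le> n" for j
  proof -
    have "of_nat m ^ j * falling_fact X j =
        (\<Sum>i=0..j. of_int ((-1) ^ (j - i) * r_whitney1 m r j i) * p i)"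
      using is_r_whitney1_r_whitney1[OF m, of r j] by (simp add: is_r_whitney1_def p_def)
    also have "\<dots> = (\<Sum>i=0..j. of_int ((-1) ^ (j + i) * r_whitney1 m r j i) * p i)"
      by (rule sum.cong) (simp_all add: minus_one_power_diff_eq_add)
    also have "\<dots> = (\<Sum>i=0..n. of_int ((-1) ^ (j + i) * r_whitney1 m r j i) * p i)"
      using that by (intro sum.mono_neutral_left) (auto simp: r_whitney1_eq_0[OF m])
    finally show ?thesis .
  qed
  have "(\<Sum>i=0..n. of_int (of_bool (i = n)) * p i) = p n"
    by (simp add: of_bool_def if_distrib[of of_int] if_distrib[of "\<lambda>c. c * _"] cong: if_cong)
  also have "\<dots> = (\<Sum>j=0..n. of_int (r_whitney2 m r n j) * (of_nat m ^ j * falling_fact X j))"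
    using is_r_whitney2_r_whitney2[OF m, of r n] by (simp add: is_r_whitney2_def p_def mult_ac)
  also have "\<dots> = (\<Sum>j=0..n. \<Sum>i=0..n.
      of_int ((-1) ^ (j + i) * r_whitney2 m r n j * r_whitney1 m r j i) * p i)"
    by (rule sum.cong) (simp_all add: w sum_distrib_left mult_ac)
  also have "\<dots> = (\<Sum>i=0..n. of_int (a i) * p i)"
    by (subst sum.swap) (simp add: a_def sum_distrib_right)
  finally have a: "a i = of_bool (i = n)"
    using graded_family_unique[OF deg nz _ True, of a "\<lambda>i. of_bool (i = n)"] by simp
  \<comment> \<open>By parity the signs differ by the factor \<open>(-1) ^ (n + i)\<close>, constant
    in \<open>j\<close> and equal to 1 at \<open>i = n\<close>, the only index where
    \<open>a i\<close> is nonzero.\<close>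
  have "(\<Sum>j=0..n. (-1) ^ (n - j) * r_whitney2 m r n j * r_whitney1 m r j i) =
      (-1) ^ (n + i) * a i"
    unfolding a_def sum_distrib_left
    by (rule sum.cong) (auto simp: minus_one_power_iff)
  also have "\<dots> = of_bool (i = n)"
    by (simp add: a)
  finally show ?thesis .
qed

text \<open>Both sides sum w(j,i) W(i,k) over the triangle \<open>k \<le> i \<le> j\<close>, in
  opposite orders.\<close>

lemma sum_r_whitney_lah:
  "(\<Sum>k=0..j. r_whitney_lah m r j k) = (\<Sum>i=0..j. r_whitney1 m r j i * r_dowling m r i)"
  unfolding r_whitney_lah_def r_dowling_def sum_distrib_left
  by (simp add: sum.Sigma, rule sum.reindex_bij_witness[of _ prod.swap prod.swap]) auto

theorem theorem5p1:
  fixes m r n :: nat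
  assumes "m \<ge> 1"
  shows "r_dowling m r n =
    (\<Sum>j=0..n. (-1) ^ (n - j) * (\<Sum>k=0..j. r_whitney_lah m r j k) * r_whitney2 m r n j)"
proof -
  have "(\<Sum>j=0..n. (-1) ^ (n - j) * (\<Sum>k=0..j. r_whitney_lah m r j k) * r_whitney2 m r n j) =
      (\<Sum>j=0..n. \<Sum>i=0..n.
        (-1) ^ (n - j) * r_whitney2 m r n j * r_whitney1 m r j i * r_dowling m r i)"
  proof (rule sum.cong)
    fix j assume "j \<in> {0..n}"
    \<comment> \<open>Padding with zero terms up to \<open>n\<close> makes the inner range
      independent of \<open>j\<close>, so the two sums can be interchanged below.\<close>
    then have "(\<Sum>k=0..j. r_whitney_lah m r j k) =
        (\<Sum>i=0..n. r_whitney1 m r j i * r_dowling m r i)"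
      unfolding sum_r_whitney_lah
      by (intro sum.mono_neutral_left) (auto simp: r_whitney1_eq_0[OF assms])
    then show "(-1) ^ (n - j) * (\<Sum>k=0..j. r_whitney_lah m r j k) * r_whitney2 m r n j =
        (\<Sum>i=0..n. (-1) ^ (n - j) * r_whitney2 m r n j * r_whitney1 m r j i * r_dowling m r i)"
      by (simp add: sum_distrib_left mult_ac)
  qed simp
  also have "\<dots> = (\<Sum>i=0..n. of_bool (i = n) * r_dowling m r i)"
    by (subst sum.swap) (simp add: sum_distrib_right[symmetric] r_whitney_orthogonal[OF assms])
  also have "\<dots> = r_dowling m r n"
    by (simp add: of_bool_def if_distrib[of "\<lambda>c. c * _"] cong: if_cong)
  finally show ?thesis ..
qed

end
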